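(* Let $F$ be a field and let $R$ be the ring of $\mathbb{Z}\times\mathbb{Z}$ matrices over $F$ defined in the context. Then $R$ is not strongly clean.
   Context: Rings are associative with $1$, not necessarily commutative. An element $a$ of a ring is strongly clean if $a=e+u$ for some idempotent $e$ and some unit $u$ with $eu=ue$; a ring is strongly clean if each of its elements is strongly clean. Definition of $R$: let $F$ be a field and let $F(\!(t)\!)$ be the field of formal Laurent series over $F$. $R$ is the set of all $\mathbb{Z}\times\mathbb{Z}$ matrices $A=(a_{i,j})_{i,j\in\mathbb{Z}}$ over $F$ for which there exist $m,n\in\mathbb{Z}$ and $f(t)=\sum_{k=k_0}^{\infty}c_kt^k\in F(\!(t)\!)$ such that (i) if $i\geq m$ or $j<n$, then $a_{i,j}=c_{j-i}$ (where $c_k:=0$ for $k<k_0$); and (ii) the submatrix $(a_{i,j})_{i<m,\,j\geq n}$ has finite rank (i.e. it has only finitely many linearly independent columns, equivalently only finitely many linearly independent rows). With the usual matrix addition and multiplication (rows of elements of $R$ are bounded from the left and columns are bounded from below, so the sums defining the products are finite), $R$ is a ring with $1$. *)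

theory Defs
  imports
    "HOL-Computational_Algebra.Formal_Laurent_Series"
    "HOL-Library.Function_Algebras"
    "HOL-Library.Groups_Big_Fun"
    "HOL-Algebra.Ring"
begin

section \<open>Strongly clean rings\<close>

definition strongly_clean_element :: "('a, 'b) ring_scheme \<Rightarrow> 'a \<Rightarrow> bool" where
  "strongly_clean_element R a \<longleftrightarrow>
     (\<exists>e\<in>carrier R. \<exists>u\<in>Units R.
        e \<otimes>\<^bsub>R\<^esub> e = e \<and> e \<otimes>\<^bsub>R\<^esub> u = u \<otimes>\<^bsub>R\<^esub> e \<and> a = e \<oplus>\<^bsub>R\<^esub> u)"

definition strongly_clean :: "('a, 'b) ring_scheme \<Rightarrow> bool" where
  "strongly_clean R \<longleftrightarrow> (\<forall>a\<in>carrier R. strongly_clean_element R a)"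


section \<open>The ring of matrices\<close>

text \<open>Columns are functions on the integers, with pointwise addition and scaling.\<close>

interpretation column: vector_space "\<lambda>(c::'a::field) (v::int \<Rightarrow> 'a) i. c * v i"
  by unfold_locales (auto simp: algebra_simps fun_eq_iff)

text \<open>The \<open>j\<close>-th column of the submatrix of rows \<open>i < m\<close>, padded with zeros.\<close>

definition upper_column :: "int \<Rightarrow> (int \<Rightarrow> int \<Rightarrow> 'a::field) \<Rightarrow> int \<Rightarrow> int \<Rightarrow> 'a" where
  "upper_column m A j = (\<lambda>i. if i < m then A i j else 0)"

definition finite_rank_corner :: "int \<Rightarrow> int \<Rightarrow> (int \<Rightarrow> int \<Rightarrow> 'a::field) \<Rightarrow> bool" where
  "finite_rank_corner m n A \<longleftrightarrow>
     (\<forall>C \<subseteq> upper_column m A ` {n..}. column.independent C \<longrightarrow> finite C)"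

text \<open>Coefficients of a Laurent series below its order are zero, so \<^const>\<open>fls_nth\<close>
  already incorporates the convention \<open>c\<^sub>k = 0\<close> for small \<open>k\<close>.\<close>

definition laurent_matrix :: "(int \<Rightarrow> int \<Rightarrow> 'a::field) \<Rightarrow> bool" where
  "laurent_matrix A \<longleftrightarrow>
     (\<exists>m n. \<exists>f :: 'a fls.
        (\<forall>i j. i \<ge> m \<or> j < n \<longrightarrow> A i j = fls_nth f (j - i)) \<and>
        finite_rank_corner m n A)"

text \<open>\<^const>\<open>Sum_any\<close> sums a family of finite support. That the products below have finite
  support is the content of the lemmas on bounds of rows and columns.\<close>

definition laurent_matrix_ring :: "(int \<Rightarrow> int \<Rightarrow> 'a::field) ring" where
  "laurent_matrix_ring =
     \<lparr>carrier = Collect laurent_matrix,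
      mult = (\<lambda>A B i j. Sum_any (\<lambda>k. A i k * B k j)),
      one = (\<lambda>i j. if i = j then 1 else 0),
      zero = (\<lambda>i j. 0),
      add = (\<lambda>A B i j. A i j + B i j)\<rparr>"


section \<open>The matrices form a ring\<close>

lemma sum_fun_apply: "sum f I x = (\<Sum>i\<in>I. f i x)"
  by (induction I rule: infinite_finite_induct) auto

lemma finite_rank_corner_iff:
  "finite_rank_corner m n A \<longleftrightarrow>
     (\<exists>S. finite S \<and> (\<forall>j\<ge>n. upper_column m A j \<in> column.span S))"
proof
  assume fr: "finite_rank_corner m n A"
  obtain S where "S \<subseteq> upper_column m A ` {n..}" "column.independent S"
    "upper_column m A ` {n..} \<subseteq> column.span S"
    by (rule column.maximal_independent_subset)
  with fr show "\<exists>S. finite S \<and> (\<forall>j\<ge>n. upper_column m A j \<in> column.span S)"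
    unfolding finite_rank_corner_def by (intro exI[of _ S]) auto
next
  assume "\<exists>S. finite S \<and> (\<forall>j\<ge>n. upper_column m A j \<in> column.span S)"
  then obtain S where S: "finite S" "upper_column m A ` {n..} \<subseteq> column.span S"
    by auto
  show "finite_rank_corner m n A"
    unfolding finite_rank_corner_def
    using column.independent_span_bound[OF S(1)] S(2) by (meson order_trans)
qed

text \<open>Finiteness of the rank does not depend on the choice of the corner.\<close>

lemma finite_rank_corner_shift:
  assumes "finite_rank_corner m n A"
  shows "finite_rank_corner m' n' A"
proof -
  obtain S where S: "finite S" "\<And>j. j \<ge> n \<Longrightarrow> upper_column m A j \<in> column.span S"
    using assms by (auto simp: finite_rank_corner_iff)
  define unit :: "int \<Rightarrow> int \<Rightarrow> 'a" where "unit i = (\<lambda>k. if k = i then 1 else 0)" for i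
  define T where "T = S \<union> upper_column m' A ` {n'..n} \<union> unit ` ({m..m'} \<union> {m'..m})"
  have "upper_column m' A j \<in> column.span T" if j: "j \<ge> n'" for j
  proof (cases "j \<le> n")
    case True
    then show ?thesis
      using j by (intro column.span_base) (auto simp: T_def)
  next
    case False
    have cor: "(\<lambda>k. upper_column m' A j k - upper_column m A j k) =
        (\<Sum>i\<in>{m..m'} \<union> {m'..m}. (\<lambda>k. (upper_column m' A j i - upper_column m A j i) * unit i k))"
      (is "?d = sum ?g ?I")
    proof
      fix k
      have "sum ?g ?I k = (\<Sum>i\<in>?I. ?g i k)"
        by (simp add: sum_fun_apply)
      also have "\<dots> = (\<Sum>i\<in>?I. if k = i then ?d i else 0)"
        by (intro sum.cong) (auto simp: unit_def)
      also have "\<dots> = ?d k"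
        by (auto simp: upper_column_def)
      finally show "?d k = sum ?g ?I k" by simp
    qed
    have "?d \<in> column.span T"
      unfolding cor
      by (intro column.span_sum column.span_scale column.span_base) (auto simp: T_def)
    moreover have "upper_column m A j \<in> column.span T"
      using S(2)[of j] False column.span_mono[of S T] by (auto simp: T_def)
    ultimately have "?d + upper_column m A j \<in> column.span T"
      by (rule column.span_add)
    moreover have "?d + upper_column m A j = upper_column m' A j"
      by (auto simp: fun_eq_iff)
    ultimately show ?thesis by simp
  qed
  moreover have "finite T" using S(1) by (simp add: T_def)
  ultimately show ?thesis by (auto simp: finite_rank_corner_iff)
qed

lemma finite_rank_corner_add:
  assumes "finite_rank_corner m n A" "finite_rank_corner m n B"
  shows "finite_rank_corner m n (\<lambda>i j. A i j + B i j)"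
proof -
  obtain S T where ST: "finite S" "finite T"
    "\<And>j. j \<ge> n \<Longrightarrow> upper_column m A j \<in> column.span S"
    "\<And>j. j \<ge> n \<Longrightarrow> upper_column m B j \<in> column.span T"
    using assms by (auto simp: finite_rank_corner_iff)
  have "upper_column m (\<lambda>i j. A i j + B i j) j \<in> column.span (S \<union> T)" if "j \<ge> n" for j
  proof -
    have "upper_column m A j + upper_column m B j \<in> column.span (S \<union> T)"
      using ST(3,4)[OF that] column.span_mono[of S "S \<union> T"] column.span_mono[of T "S \<union> T"]
      by (intro column.span_add) auto
    also have "upper_column m A j + upper_column m B j = upper_column m (\<lambda>i j. A i j + B i j) j"
      by (auto simp: upper_column_def fun_eq_iff)
    finally show ?thesis .
  qed
  then show ?thesis
    using ST(1,2) by (auto simp: finite_rank_corner_iff intro!: exI[of _ "S \<union> T"])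
qed

lemma laurent_matrix_add:
  assumes "laurent_matrix A" "laurent_matrix B"
  shows "laurent_matrix (\<lambda>i j. A i j + B i j)"
proof -
  obtain m n f where A: "\<And>i j. i \<ge> m \<or> j < n \<Longrightarrow> A i j = fls_nth f (j - i)"
    "finite_rank_corner m n A"
    using assms(1) unfolding laurent_matrix_def by blast
  obtain m' n' g where B: "\<And>i j. i \<ge> m' \<or> j < n' \<Longrightarrow> B i j = fls_nth g (j - i)"
    "finite_rank_corner m' n' B"
    using assms(2) unfolding laurent_matrix_def by blast
  show ?thesis
    unfolding laurent_matrix_def
    by (rule exI[of _ "max m m'"], rule exI[of _ "min n n'"], rule exI[of _ "f + g"])
       (auto simp: A(1) B(1) intro!: finite_rank_corner_add
          finite_rank_corner_shift[OF A(2)] finite_rank_corner_shift[OF B(2)])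
qed

lemma finite_rank_corner_const_0:
  assumes "\<And>i j. i < m \<Longrightarrow> j \<ge> n \<Longrightarrow> A i j = 0"
  shows "finite_rank_corner m n A"
proof -
  have "upper_column m A j = 0" if "j \<ge> n" for j
    using assms that by (auto simp: upper_column_def fun_eq_iff)
  then show ?thesis
    by (auto simp: finite_rank_corner_iff intro!: exI[of _ "{}"])
qed

lemma laurent_matrix_0: "laurent_matrix (\<lambda>i j. 0)"
  unfolding laurent_matrix_def
  by (rule exI[of _ 0], rule exI[of _ 0], rule exI[of _ 0])
     (auto intro: finite_rank_corner_const_0)

lemma laurent_matrix_1: "laurent_matrix (\<lambda>i j. if i = j then 1 else 0)"
  unfolding laurent_matrix_def
  by (rule exI[of _ 0], rule exI[of _ 0], rule exI[of _ 1])
     (auto intro: finite_rank_corner_const_0)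

lemma laurent_matrix_uminus:
  assumes "laurent_matrix A"
  shows "laurent_matrix (\<lambda>i j. - A i j)"
proof -
  obtain m n f where A: "\<And>i j. i \<ge> m \<or> j < n \<Longrightarrow> A i j = fls_nth f (j - i)"
    "finite_rank_corner m n A"
    using assms unfolding laurent_matrix_def by blast
  obtain S where S: "finite S" "\<And>j. j \<ge> n \<Longrightarrow> upper_column m A j \<in> column.span S"
    using A(2) by (auto simp: finite_rank_corner_iff)
  have "upper_column m (\<lambda>i j. - A i j) j = - upper_column m A j" for j
    by (auto simp: upper_column_def fun_eq_iff)
  then have "finite_rank_corner m n (\<lambda>i j. - A i j)"
    using S by (auto simp: finite_rank_corner_iff intro!: column.span_neg)
  then show ?thesis
    unfolding laurent_matrix_def
    by (intro exI[of _ m] exI[of _ n] exI[of _ "- f"]) (auto simp: A(1))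
qed

lemma laurent_matrix_row_bound:
  assumes "laurent_matrix A"
  obtains N d where "\<And>i k. A i k \<noteq> 0 \<Longrightarrow> k \<ge> min N (i + d)"
proof -
  obtain m n f where A: "\<And>i j. i \<ge> m \<or> j < n \<Longrightarrow> A i j = fls_nth f (j - i)"
    using assms unfolding laurent_matrix_def by blast
  have "k \<ge> min n (i + fls_subdegree f)" if "A i k \<noteq> 0" for i k
    using that A[of i k] fls_subdegree_leI[of f "k - i"] by (cases "k < n") auto
  then show thesis by (rule that)
qed

lemma laurent_matrix_column_bound:
  assumes "laurent_matrix A"
  obtains M d where "\<And>k j. A k j \<noteq> 0 \<Longrightarrow> k \<le> max M (j + d)"
proof -
  obtain m n f where A: "\<And>i j. i \<ge> m \<or> j < n \<Longrightarrow> A i j = fls_nth f (j - i)"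
    using assms unfolding laurent_matrix_def by blast
  have "k \<le> max m (j + (- fls_subdegree f))" if "A k j \<noteq> 0" for k j
    using that A[of k j] fls_subdegree_leI[of f "j - k"] by (cases "k \<ge> m") auto
  then show thesis by (rule that)
qed

lemma Sum_any_eq_sum:
  assumes "finite I" "\<And>k. g k \<noteq> 0 \<Longrightarrow> k \<in> I"
  shows "Sum_any g = sum g I"
  using assms by (intro Sum_any.expand_superset) auto

lemma laurent_matrix_mult_support:
  assumes "laurent_matrix A" "laurent_matrix B"
  obtains l u where "\<And>i j k. A i k * B k j \<noteq> 0 \<Longrightarrow> l i \<le> k \<and> k \<le> u j"
    and "mono l" and "mono u"
    and "\<And>i k. A i k \<noteq> 0 \<Longrightarrow> l i \<le> k" and "\<And>k j. B k j \<noteq> 0 \<Longrightarrow> k \<le> u j"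
proof -
  obtain N d where 1: "\<And>i k. A i k \<noteq> 0 \<Longrightarrow> k \<ge> min N (i + d)"
    using laurent_matrix_row_bound[OF assms(1)] by blast
  obtain M c where 2: "\<And>k j. B k j \<noteq> 0 \<Longrightarrow> k \<le> max M (j + c)"
    using laurent_matrix_column_bound[OF assms(2)] by blast
  show thesis
    by (rule that[of "\<lambda>i. min N (i + d)" "\<lambda>j. max M (j + c)"])
       (use 1 2 in \<open>force simp: mono_def\<close>)+
qed

lemma finite_laurent_matrix_mult_support:
  assumes "laurent_matrix A" "laurent_matrix B"
  shows "finite {k. A i k * B k j \<noteq> 0}"
proof -
  obtain l u where "\<And>i j k. A i k * B k j \<noteq> 0 \<Longrightarrow> l i \<le> k \<and> k \<le> u j"
    using laurent_matrix_mult_support[OF assms] by metis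
  then have "{k. A i k * B k j \<noteq> 0} \<subseteq> {l i..u j}" by auto
  then show ?thesis by (rule finite_subset) simp
qed

lemma fls_times_nth_Sum_any:
  fixes f g :: "'a::field fls"
  shows "Sum_any (\<lambda>k. fls_nth f (k - i) * fls_nth g (j - k)) = fls_nth (f * g) (j - i)"
proof -
  let ?I = "{fls_subdegree f..j - i - fls_subdegree g}"
  have "Sum_any (\<lambda>k. fls_nth f (k - i) * fls_nth g (j - k)) =
      (\<Sum>k\<in>(+) i ` ?I. fls_nth f (k - i) * fls_nth g (j - k))"
  proof (rule Sum_any_eq_sum)
    fix k assume "fls_nth f (k - i) * fls_nth g (j - k) \<noteq> 0"
    then have "fls_subdegree f \<le> k - i" "fls_subdegree g \<le> j - k"
      by (auto intro: fls_subdegree_leI)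
    then have "k = i + (k - i)" "k - i \<in> ?I" by auto
    then show "k \<in> (+) i ` ?I" by blast
  qed simp
  also have "\<dots> = (\<Sum>k\<in>?I. fls_nth f k * fls_nth g (j - i - k))"
    by (subst sum.reindex) (auto simp: algebra_simps)
  also have "\<dots> = fls_nth (f * g) (j - i)"
    by (simp add: fls_times_nth(2))
  finally show ?thesis .
qed

lemma finite_rank_corner_mult:
  assumes "laurent_matrix A" "laurent_matrix B"
  shows "finite_rank_corner m n (\<lambda>i j. Sum_any (\<lambda>k. A i k * B k j))"
    (is "finite_rank_corner m n ?C")
proof -
  obtain l u where lu: "\<And>i j k. A i k * B k j \<noteq> 0 \<Longrightarrow> l i \<le> k \<and> k \<le> u j"
    using laurent_matrix_mult_support[OF assms] by metis
  have "finite_rank_corner m 0 A" "finite_rank_corner 0 n B"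
    using assms finite_rank_corner_shift unfolding laurent_matrix_def by blast+
  then obtain S T where S: "finite S" "\<And>j. j \<ge> 0 \<Longrightarrow> upper_column m A j \<in> column.span S"
    and T: "finite T" "\<And>j. j \<ge> n \<Longrightarrow> upper_column 0 B j \<in> column.span T"
    by (auto simp: finite_rank_corner_iff)
  define L where "L v = (\<lambda>i. if i < m then \<Sum>k\<in>{l i..<0}. A i k * v k else 0)" for v
  have L_span: "L v \<in> column.span (L ` T)" if "v \<in> column.span T" for v
    using that
  proof (induction rule: column.span_induct_alt)
    case base
    have "L 0 = 0" by (auto simp: L_def fun_eq_iff)
    then show ?case using column.span_zero[of "L ` T"] by (simp add: zero_fun_def)
  next
    case (step c x y)
    have "L ((\<lambda>i. c * x i) + y) = (\<lambda>i. c * L x i) + L y"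
      by (auto simp: L_def fun_eq_iff algebra_simps sum.distrib sum_distrib_left)
    moreover have "(\<lambda>i. c * L x i) + L y \<in> column.span (L ` T)"
      using step by (intro column.span_add[OF column.span_scale[OF column.span_base]]) auto
    ultimately show ?case by (simp add: plus_fun_def)
  qed
  have "upper_column m ?C j \<in> column.span (S \<union> L ` T)" if j: "j \<ge> n" for j
  proof -
    let ?E = "\<Sum>k\<in>{0..u j}. (\<lambda>i. B k j * upper_column m A k i)"
    have "?E \<in> column.span (S \<union> L ` T)"
      using S(2) column.span_mono[of S "S \<union> L ` T"]
      by (intro column.span_sum column.span_scale) auto
    moreover have "L (upper_column 0 B j) \<in> column.span (S \<union> L ` T)"
      using L_span[OF T(2)[OF j]] column.span_mono[of "L ` T" "S \<union> L ` T"] by auto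
    ultimately have "?E + L (upper_column 0 B j) \<in> column.span (S \<union> L ` T)"
      by (rule column.span_add)
    moreover have "?E + L (upper_column 0 B j) = upper_column m ?C j"
    proof
      fix i
      have "?C i j = (\<Sum>k\<in>{0..u j} \<union> {l i..<0}. A i k * B k j)"
        by (rule Sum_any_eq_sum) (use lu in force)+
      also have "\<dots> = (\<Sum>k\<in>{0..u j}. A i k * B k j) + (\<Sum>k\<in>{l i..<0}. A i k * B k j)"
        by (rule sum.union_disjoint) auto
      finally show "(?E + L (upper_column 0 B j)) i = upper_column m ?C j i"
        by (auto simp: upper_column_def L_def sum_fun_apply mult.commute)
    qed
    ultimately show ?thesis by simp
  qed
  then show ?thesis
    using S(1) T(1) unfolding finite_rank_corner_iff by (intro exI[of _ "S \<union> L ` T"]) auto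
qed

lemma laurent_matrix_mult:
  assumes "laurent_matrix A" "laurent_matrix B"
  shows "laurent_matrix (\<lambda>i j. Sum_any (\<lambda>k. A i k * B k j))"
proof -
  obtain m n f where A: "\<And>i j. i \<ge> m \<or> j < n \<Longrightarrow> A i j = fls_nth f (j - i)"
    using assms(1) unfolding laurent_matrix_def by blast
  obtain m' n' g where B: "\<And>i j. i \<ge> m' \<or> j < n' \<Longrightarrow> B i j = fls_nth g (j - i)"
    using assms(2) unfolding laurent_matrix_def by blast
  define M where "M = max m (m' - fls_subdegree f)"
  define N where "N = min n' (n + fls_subdegree g)"
  have "Sum_any (\<lambda>k. A i k * B k j) = fls_nth (f * g) (j - i)" if ij: "i \<ge> M \<or> j < N" for i j
  proof -
    have "A i k * B k j = fls_nth f (k - i) * fls_nth g (j - k)" for k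
    proof (cases "i \<ge> M")
      case True
      have "B k j = fls_nth g (j - k)" if "fls_nth f (k - i) \<noteq> 0"
        using True fls_subdegree_leI[OF that] by (intro B) (auto simp: M_def)
      then show ?thesis using True by (auto simp: A M_def)
    next
      case False
      with ij have "j < N" by simp
      have "A i k = fls_nth f (k - i)" if "fls_nth g (j - k) \<noteq> 0"
        using \<open>j < N\<close> fls_subdegree_leI[OF that] by (intro A) (auto simp: N_def)
      then show ?thesis using \<open>j < N\<close> by (auto simp: B N_def)
    qed
    then show ?thesis by (simp add: fls_times_nth_Sum_any)
  qed
  then show ?thesis
    unfolding laurent_matrix_def using finite_rank_corner_mult[OF assms] by blast
qed

lemma laurent_matrix_mult_assoc:
  assumes "laurent_matrix A" "laurent_matrix B" "laurent_matrix C"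
  shows "Sum_any (\<lambda>k. Sum_any (\<lambda>l. A i l * B l k) * C k j) =
         Sum_any (\<lambda>l. A i l * Sum_any (\<lambda>k. B l k * C k j))"
proof -
  obtain a b where ab: "\<And>i j k. A i k * B k j \<noteq> 0 \<Longrightarrow> a i \<le> k \<and> k \<le> b j" "mono b"
    "\<And>i k. A i k \<noteq> 0 \<Longrightarrow> a i \<le> k" "\<And>k j. B k j \<noteq> 0 \<Longrightarrow> k \<le> b j"
    using laurent_matrix_mult_support[OF assms(1,2)] by metis
  obtain c d where cd: "\<And>i j k. B i k * C k j \<noteq> 0 \<Longrightarrow> c i \<le> k \<and> k \<le> d j" "mono c"
    "\<And>i k. B i k \<noteq> 0 \<Longrightarrow> c i \<le> k" "\<And>k j. C k j \<noteq> 0 \<Longrightarrow> k \<le> d j"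
    using laurent_matrix_mult_support[OF assms(2,3)] by metis
  let ?L = "{a i..b (d j)}" and ?K = "{c (a i)..d j}"
  have box: "l \<in> ?L \<and> k \<in> ?K" if "A i l \<noteq> 0" "B l k \<noteq> 0" "C k j \<noteq> 0" for l k
  proof -
    have "a i \<le> l" "k \<le> d j" "c l \<le> k" "l \<le> b k"
      using that ab cd by auto
    moreover have "c (a i) \<le> c l" "b k \<le> b (d j)"
      using calculation ab(2) cd(2) by (auto simp: mono_def)
    ultimately show ?thesis by auto
  qed
  have left: "Sum_any (\<lambda>l. A i l * B l k) * C k j = (\<Sum>l\<in>?L. A i l * B l k * C k j)" for k
  proof (cases "C k j = 0")
    case False
    then have "Sum_any (\<lambda>l. A i l * B l k) = (\<Sum>l\<in>?L. A i l * B l k)"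
      using box by (intro Sum_any_eq_sum) auto
    then show ?thesis by (simp add: sum_distrib_right)
  qed simp
  have right: "A i l * Sum_any (\<lambda>k. B l k * C k j) = (\<Sum>k\<in>?K. A i l * B l k * C k j)" for l
  proof (cases "A i l = 0")
    case False
    then have "Sum_any (\<lambda>k. B l k * C k j) = (\<Sum>k\<in>?K. B l k * C k j)"
      using box by (intro Sum_any_eq_sum) auto
    then show ?thesis by (simp add: sum_distrib_left mult.assoc)
  qed simp
  have "Sum_any (\<lambda>k. \<Sum>l\<in>?L. A i l * B l k * C k j) = (\<Sum>k\<in>?K. \<Sum>l\<in>?L. A i l * B l k * C k j)"
    using box by (intro Sum_any_eq_sum) (auto elim!: sum.not_neutral_contains_not_neutral)
  also have "\<dots> = (\<Sum>l\<in>?L. \<Sum>k\<in>?K. A i l * B l k * C k j)"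
    by (rule sum.swap)
  also have "\<dots> = Sum_any (\<lambda>l. \<Sum>k\<in>?K. A i l * B l k * C k j)"
    using box by (intro Sum_any_eq_sum[symmetric]) (auto elim!: sum.not_neutral_contains_not_neutral)
  finally show ?thesis by (simp add: left right)
qed

lemma laurent_matrix_ring_is_ring: "ring (laurent_matrix_ring :: (int \<Rightarrow> int \<Rightarrow> 'a::field) ring)"
proof (rule ringI)
  show "abelian_group (laurent_matrix_ring :: (int \<Rightarrow> int \<Rightarrow> 'a::field) ring)"
  proof (rule abelian_groupI)
    fix A assume "A \<in> carrier (laurent_matrix_ring :: (int \<Rightarrow> int \<Rightarrow> 'a::field) ring)"
    then show "\<exists>B\<in>carrier laurent_matrix_ring. B \<oplus>\<^bsub>laurent_matrix_ring\<^esub> A = \<zero>\<^bsub>laurent_matrix_ring\<^esub>"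
      by (intro bexI[of _ "\<lambda>i j. - A i j"])
         (auto simp: laurent_matrix_ring_def laurent_matrix_uminus)
  qed (auto simp: laurent_matrix_ring_def laurent_matrix_add laurent_matrix_0 algebra_simps)
  show "Group.monoid (laurent_matrix_ring :: (int \<Rightarrow> int \<Rightarrow> 'a::field) ring)"
  proof (rule monoidI)
    fix A assume "A \<in> carrier (laurent_matrix_ring :: (int \<Rightarrow> int \<Rightarrow> 'a::field) ring)"
    have "Sum_any (\<lambda>k. (if i = k then 1 else 0) * A k j) = A i j" for i j
      by (subst Sum_any_eq_sum[of "{i}"]) (auto split: if_splits)
    then show "\<one>\<^bsub>laurent_matrix_ring\<^esub> \<otimes>\<^bsub>laurent_matrix_ring\<^esub> A = A"
      by (simp add: laurent_matrix_ring_def fun_eq_iff)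
    have "Sum_any (\<lambda>k. A i k * (if k = j then 1 else 0)) = A i j" for i j
      by (subst Sum_any_eq_sum[of "{j}"]) (auto split: if_splits)
    then show "A \<otimes>\<^bsub>laurent_matrix_ring\<^esub> \<one>\<^bsub>laurent_matrix_ring\<^esub> = A"
      by (simp add: laurent_matrix_ring_def fun_eq_iff)
  qed (auto simp: laurent_matrix_ring_def laurent_matrix_mult laurent_matrix_1
         laurent_matrix_mult_assoc)
next
  fix A B C assume "A \<in> carrier (laurent_matrix_ring :: (int \<Rightarrow> int \<Rightarrow> 'a::field) ring)"
    "B \<in> carrier (laurent_matrix_ring :: (int \<Rightarrow> int \<Rightarrow> 'a::field) ring)"
    "C \<in> carrier (laurent_matrix_ring :: (int \<Rightarrow> int \<Rightarrow> 'a::field) ring)"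
  then have "laurent_matrix A" "laurent_matrix B" "laurent_matrix C"
    by (auto simp: laurent_matrix_ring_def)
  note fin = this[THEN finite_laurent_matrix_mult_support]
  show "(A \<oplus>\<^bsub>laurent_matrix_ring\<^esub> B) \<otimes>\<^bsub>laurent_matrix_ring\<^esub> C =
      A \<otimes>\<^bsub>laurent_matrix_ring\<^esub> C \<oplus>\<^bsub>laurent_matrix_ring\<^esub> B \<otimes>\<^bsub>laurent_matrix_ring\<^esub> C"
    using fin(1)[OF \<open>laurent_matrix C\<close>] fin(2)[OF \<open>laurent_matrix C\<close>]
    by (simp add: laurent_matrix_ring_def fun_eq_iff distrib_right Sum_any.distrib)
  show "C \<otimes>\<^bsub>laurent_matrix_ring\<^esub> (A \<oplus>\<^bsub>laurent_matrix_ring\<^esub> B) =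
      C \<otimes>\<^bsub>laurent_matrix_ring\<^esub> A \<oplus>\<^bsub>laurent_matrix_ring\<^esub> C \<otimes>\<^bsub>laurent_matrix_ring\<^esub> B"
    using fin(3)[OF \<open>laurent_matrix A\<close>] fin(3)[OF \<open>laurent_matrix B\<close>]
    by (simp add: laurent_matrix_ring_def fun_eq_iff distrib_left Sum_any.distrib)
qed

end

theory Submission
  imports Defs
begin

text \<open>Let the matrices act from the right on row vectors, that is on \<open>F((t))\<close>. The
  counterexample is multiplication by \<open>t\<^sup>-\<^sup>1\<close> followed by deletion of the coefficient
  of \<open>t\<^sup>-\<^sup>1\<close>. Write it as \<open>e + u\<close> with \<open>e\<close> idempotent and commuting with the unit
  \<open>u\<close>. The Laurent series attached to \<open>e\<close> is an idempotent of a field, hence \<open>0\<close> or \<open>1\<close>,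
  so one of \<open>d = e\<close>, \<open>d = e - 1\<close> has only finitely many nonzero rows with positive index.
  Correspondingly let \<open>B\<close> be the counterexample itself or the counterexample minus \<open>1\<close>, so
  that \<open>B = d + u\<close>. The vectors \<open>x\<^sub>N = t\<^sup>N\<close>, respectively \<open>x\<^sub>N = t\<^sup>N/(1 - t)\<^sup>N\<^sup>+\<^sup>1\<close>,
  form an infinite chain \<open>x\<^sub>N B = x\<^sub>N\<^sub>-\<^sub>1\<close>, \<open>x\<^sub>0 B = 0\<close>, and \<open>d\<close> kills \<open>x\<^sub>N\<close> for large
  \<open>N\<close>. Since \<open>d\<close> commutes with \<open>B\<close>, it kills \<open>x\<^sub>0\<close> too. Hence \<open>x\<^sub>0 u = 0\<close>, which is absurd.\<close>

lemma (in ring) kernel_chain_eq_zero: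
  fixes X :: "nat \<Rightarrow> 'a"
  assumes d: "d \<in> carrier R" and u: "u \<in> Units R" and comm: "d \<otimes> u = u \<otimes> d"
    and X: "\<And>n. X n \<in> carrier R"
    and step: "\<And>n. X (Suc n) \<otimes> (d \<oplus> u) = X n"
    and base: "X 0 \<otimes> (d \<oplus> u) = \<zero>"
    and killed: "X m \<otimes> d = \<zero>"
  shows "X 0 = \<zero>"
proof -
  have uc: "u \<in> carrier R" using u by auto
  have swap: "(d \<oplus> u) \<otimes> d = d \<otimes> (d \<oplus> u)"
    using d uc comm by (simp add: l_distr r_distr)
  have down: "X n \<otimes> d = \<zero>" if "X (Suc n) \<otimes> d = \<zero>" for n
  proof -
    have "X n \<otimes> d = X (Suc n) \<otimes> ((d \<oplus> u) \<otimes> d)"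
      using d uc X by (simp flip: step[of n] add: m_assoc)
    also have "\<dots> = (X (Suc n) \<otimes> d) \<otimes> (d \<oplus> u)"
      using d uc X by (simp add: swap m_assoc)
    finally show ?thesis using that d uc by simp
  qed
  have "X 0 \<otimes> d = \<zero>"
    using killed by (induction m) (auto intro: down)
  then have "X 0 \<otimes> u = \<zero>"
    using base d uc X by (simp add: r_distr)
  then have "X 0 \<otimes> (u \<otimes> inv u) = \<zero>"
    using u uc X Units_inv_closed[OF u] by (simp del: Units_r_inv flip: m_assoc)
  then show ?thesis using u X by simp
qed

lemma laurent_matrix_symbol:
  assumes "laurent_matrix A"
  obtains m f where "\<And>i j. i \<ge> m \<Longrightarrow> A i j = fls_nth f (j - i)"
  using assms unfolding laurent_matrix_def by blast

text \<open>Far enough down, the rows of the square of \<open>E\<close> are given by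
  \<open>f * f\<close>, and a field has no idempotents besides 0 and 1.\<close>

lemma idempotent_symbol:
  fixes E :: "int \<Rightarrow> int \<Rightarrow> 'a::field"
  assumes E: "\<And>i j. i \<ge> m \<Longrightarrow> E i j = fls_nth f (j - i)"
    and idem: "\<And>i j. Sum_any (\<lambda>k. E i k * E k j) = E i j"
  shows "f = 0 \<or> f = 1"
proof -
  have "fls_nth (f * f) n = fls_nth f n" for n
  proof -
    \<comment> \<open>Row \<open>i\<close> is so low that \<open>fls_nth f (k - i)\<close> vanishes
      for all \<open>k < m\<close>, so only rows of \<open>E\<close> governed by \<open>f\<close>
      enter the product.\<close>
    define i where "i = max m (m - fls_subdegree f)"
    have "E i k * E k (i + n) = fls_nth f (k - i) * fls_nth f (i + n - k)" for k
      using fls_subdegree_leI[of f "k - i"] by (cases "k \<ge> m") (auto simp: E i_def)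
    then have "E i (i + n) = fls_nth (f * f) n"
      using idem[of i "i + n"] by (simp add: fls_times_nth_Sum_any)
    then show ?thesis by (simp add: E i_def)
  qed
  then have "f * f = f" by (intro fls_eqI)
  then show ?thesis by simp
qed

text \<open>Row vectors are encoded as elements of the ring, so that their chain conditions are
  equations in the ring.\<close>

definition row_matrix :: "(int \<Rightarrow> 'a::field) \<Rightarrow> int \<Rightarrow> int \<Rightarrow> 'a" where
  "row_matrix x i j = (if i = 0 then x j else 0)"

lemma laurent_matrix_row_matrix:
  assumes "\<And>j. j < 0 \<Longrightarrow> x j = 0"
  shows "laurent_matrix (row_matrix x)"
proof -
  define v :: "int \<Rightarrow> 'a" where "v i = (if i = 0 then 1 else 0)" for i
  have "upper_column 1 (row_matrix x) j = (\<lambda>i. x j * v i)" for j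
    by (auto simp: upper_column_def row_matrix_def v_def fun_eq_iff)
  then have "finite_rank_corner 1 0 (row_matrix x)"
    unfolding finite_rank_corner_iff
    by (intro exI[of _ "{v}"]) (auto intro: column.span_scale[OF column.span_base])
  then show ?thesis
    unfolding laurent_matrix_def
    by (intro exI[of _ 1] exI[of _ 0] exI[of _ 0]) (auto simp: row_matrix_def assms)
qed

lemma row_matrix_mult:
  "row_matrix x \<otimes>\<^bsub>laurent_matrix_ring\<^esub> B = row_matrix (\<lambda>j. Sum_any (\<lambda>k. x k * B k j))"
  by (auto simp: laurent_matrix_ring_def row_matrix_def fun_eq_iff)

definition cut_shift :: "int \<Rightarrow> int \<Rightarrow> 'a::field" where
  "cut_shift i j = (if j = i - 1 \<and> i \<noteq> 0 then 1 else 0)"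

lemma laurent_matrix_cut_shift: "laurent_matrix cut_shift"
  unfolding laurent_matrix_def
  \<comment> \<open>Within the corner \<open>i < 1\<close>, \<open>j \<ge> -1\<close>, the shift has
    its only nonzero entry at \<open>(0, -1)\<close>, the deleted one, so the corner is
    zero.\<close>
  by (rule exI[of _ 1], rule exI[of _ "-1"], rule exI[of _ fls_X_inv])
     (auto simp: cut_shift_def intro!: finite_rank_corner_const_0)

lemma row_matrix_mult_cut_shift:
  "row_matrix x \<otimes>\<^bsub>laurent_matrix_ring\<^esub> cut_shift =
     row_matrix (\<lambda>j. if j = -1 then 0 else x (j + 1))"
proof -
  have "Sum_any (\<lambda>k. x k * cut_shift k j) = (if j = -1 then 0 else x (j + 1))" for j
    by (subst Sum_any_eq_sum[of "{j + 1}"]) (auto simp: cut_shift_def split: if_splits)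
  then show ?thesis by (simp add: row_matrix_mult)
qed

definition monomial_row :: "nat \<Rightarrow> int \<Rightarrow> 'a::field" where
  "monomial_row n j = (if j = int n then 1 else 0)"

text \<open>The coefficients of \<open>t\<^sup>n/(1 - t)\<^sup>n\<^sup>+\<^sup>1\<close>.\<close>

definition binomial_row :: "nat \<Rightarrow> int \<Rightarrow> 'a::field" where
  "binomial_row n j = (if j < 0 then 0 else of_nat (nat j choose n))"

text \<open>Pascal's rule. The coefficient deleted at \<open>j = -1\<close> is
  \<open>0 choose Suc n = 0\<close>; deletion only affects the last link of the chain,
  \<open>binomial_row 0\<close>.\<close>

lemma binomial_row_step:
  "(if j = -1 then 0 else binomial_row (Suc n) (j + 1)) =
     binomial_row n j + (binomial_row (Suc n) j :: 'a::field)"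
proof (cases "j < 0")
  case False
  then have "nat (j + 1) = Suc (nat j)" by simp
  with False show ?thesis by (simp add: binomial_row_def)
qed (auto simp: binomial_row_def)

lemma row_matrix_add:
  "row_matrix x \<oplus>\<^bsub>laurent_matrix_ring\<^esub> row_matrix y = row_matrix (\<lambda>j. x j + y j)"
  by (auto simp: laurent_matrix_ring_def row_matrix_def fun_eq_iff)

lemma row_matrix_eq_0_iff:
  "row_matrix x = \<zero>\<^bsub>laurent_matrix_ring\<^esub> \<longleftrightarrow> (\<forall>j. x j = 0)"
  by (auto simp: laurent_matrix_ring_def row_matrix_def fun_eq_iff)

lemma row_matrix_mult_eq_0:
  assumes "\<And>i j. i \<ge> m \<Longrightarrow> D i j = 0" and "\<And>k. k < m \<Longrightarrow> x k = 0"
  shows "row_matrix x \<otimes>\<^bsub>laurent_matrix_ring\<^esub> D = \<zero>\<^bsub>laurent_matrix_ring\<^esub>"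
proof -
  have "x k * D k j = 0" for k j
    using assms[of k] by (cases "k < m") auto
  then have "Sum_any (\<lambda>k. x k * D k j) = 0" for j
    by (simp only: Sum_any.neutral)
  then show ?thesis by (simp add: row_matrix_mult row_matrix_eq_0_iff)
qed

lemma cut_shift_not_strongly_clean:
  "\<not> strongly_clean_element laurent_matrix_ring (cut_shift :: int \<Rightarrow> int \<Rightarrow> 'a::field)"
proof
  define R where "R = (laurent_matrix_ring :: (int \<Rightarrow> int \<Rightarrow> 'a) ring)"
  interpret ring R unfolding R_def by (rule laurent_matrix_ring_is_ring)
  assume "strongly_clean_element laurent_matrix_ring (cut_shift :: int \<Rightarrow> int \<Rightarrow> 'a)"
  then obtain e u where e: "e \<in> carrier R" and u: "u \<in> Units R" and idem: "e \<otimes>\<^bsub>R\<^esub> e = e"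
    and comm: "e \<otimes>\<^bsub>R\<^esub> u = u \<otimes>\<^bsub>R\<^esub> e" and sum: "cut_shift = e \<oplus>\<^bsub>R\<^esub> u"
    unfolding strongly_clean_element_def R_def by blast
  have uc: "u \<in> carrier R" using u by auto
  have mono: "row_matrix (monomial_row n) \<in> carrier R" for n
    by (auto simp: R_def laurent_matrix_ring_def monomial_row_def intro!: laurent_matrix_row_matrix)
  have bin: "row_matrix (binomial_row n) \<in> carrier R" for n
    by (auto simp: R_def laurent_matrix_ring_def binomial_row_def intro!: laurent_matrix_row_matrix)
  obtain m f where f: "\<And>i j. i \<ge> m \<Longrightarrow> e i j = fls_nth f (j - i)"
    using e laurent_matrix_symbol[of e] by (auto simp: R_def laurent_matrix_ring_def)
  have "Sum_any (\<lambda>k. e i k * e k j) = e i j" for i j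
    using fun_cong[OF fun_cong[OF idem], of i j] by (simp add: R_def laurent_matrix_ring_def)
  with f consider "f = 0" | "f = 1" using idempotent_symbol by blast
  then show False
  proof cases
    case 1
    have "row_matrix (monomial_row 0) = \<zero>\<^bsub>R\<^esub>"
    proof (rule kernel_chain_eq_zero[OF e u comm mono])
      show "row_matrix (monomial_row (Suc n)) \<otimes>\<^bsub>R\<^esub> (e \<oplus>\<^bsub>R\<^esub> u) = row_matrix (monomial_row n)" for n
        unfolding sum[symmetric] unfolding R_def row_matrix_mult_cut_shift
        by (auto simp: monomial_row_def row_matrix_def fun_eq_iff)
      show "row_matrix (monomial_row 0) \<otimes>\<^bsub>R\<^esub> (e \<oplus>\<^bsub>R\<^esub> u) = \<zero>\<^bsub>R\<^esub>"
        unfolding sum[symmetric] unfolding R_def row_matrix_mult_cut_shift row_matrix_eq_0_iff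
        by (auto simp: monomial_row_def)
      \<comment> \<open>The monomial sits at index \<open>nat m \<ge> m\<close>, where the rows of
        \<open>e\<close> vanish.\<close>
      show "row_matrix (monomial_row (nat m)) \<otimes>\<^bsub>R\<^esub> e = \<zero>\<^bsub>R\<^esub>"
        unfolding R_def by (rule row_matrix_mult_eq_0[of m]) (auto simp: f 1 monomial_row_def)
    qed
    then show False by (auto simp: R_def row_matrix_eq_0_iff monomial_row_def dest: spec[of _ 0])
  next
    case 2
    define d where "d = e \<ominus>\<^bsub>R\<^esub> \<one>\<^bsub>R\<^esub>"
    have d: "d \<in> carrier R" using e by (simp add: d_def)
    have ed: "e = d \<oplus>\<^bsub>R\<^esub> \<one>\<^bsub>R\<^esub>" using e by (simp add: d_def minus_eq a_assoc l_neg)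
    have "e i j = d i j + (if i = j then 1 else 0)" for i j
      using fun_cong[OF fun_cong[OF ed], of i j] by (simp add: R_def laurent_matrix_ring_def)
    then have drow: "d i j = 0" if "i \<ge> m" for i j
      using f[OF that, of j] by (auto simp: 2 split: if_splits)
    have commd: "d \<otimes>\<^bsub>R\<^esub> u = u \<otimes>\<^bsub>R\<^esub> d"
      using e uc comm by (simp add: d_def minus_eq l_distr r_distr l_minus r_minus)
    \<comment> \<open>Since \<open>d + u\<close> is \<open>cut_shift - 1\<close>, the chain
      conditions can be checked on \<open>cut_shift\<close> alone.\<close>
    have shift: "x \<otimes>\<^bsub>R\<^esub> (d \<oplus>\<^bsub>R\<^esub> u) = y"
      if "x \<in> carrier R" "y \<in> carrier R" "x \<otimes>\<^bsub>R\<^esub> cut_shift = y \<oplus>\<^bsub>R\<^esub> x" for x y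
    proof -
      have "cut_shift = (d \<oplus>\<^bsub>R\<^esub> u) \<oplus>\<^bsub>R\<^esub> \<one>\<^bsub>R\<^esub>"
        using d uc by (simp add: sum ed a_ac)
      then have "x \<otimes>\<^bsub>R\<^esub> (d \<oplus>\<^bsub>R\<^esub> u) \<oplus>\<^bsub>R\<^esub> x = y \<oplus>\<^bsub>R\<^esub> x"
        using that d uc r_distr[of "d \<oplus>\<^bsub>R\<^esub> u" "\<one>\<^bsub>R\<^esub>" x]
        by (simp only: a_closed one_closed r_one)
      then show ?thesis
        using that d uc by (simp only: add.right_cancel m_closed a_closed)
    qed
    have "row_matrix (binomial_row 0) = \<zero>\<^bsub>R\<^esub>"
    proof (rule kernel_chain_eq_zero[OF d u commd bin])
      show "row_matrix (binomial_row (Suc n)) \<otimes>\<^bsub>R\<^esub> (d \<oplus>\<^bsub>R\<^esub> u) = row_matrix (binomial_row n)" for n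
        by (rule shift[OF bin bin])
           (simp add: R_def row_matrix_mult_cut_shift binomial_row_step row_matrix_add)
      show "row_matrix (binomial_row 0) \<otimes>\<^bsub>R\<^esub> (d \<oplus>\<^bsub>R\<^esub> u) = \<zero>\<^bsub>R\<^esub>"
      proof (rule shift[OF bin zero_closed])
        \<comment> \<open>Shifting \<open>1/(1 - t)\<close> adds just the term at index -1, which is
          deleted.\<close>
        have "row_matrix (binomial_row 0) \<otimes>\<^bsub>R\<^esub> cut_shift = row_matrix (binomial_row 0)"
          unfolding R_def row_matrix_mult_cut_shift
          by (auto simp: row_matrix_def binomial_row_def fun_eq_iff)
        then show "row_matrix (binomial_row 0) \<otimes>\<^bsub>R\<^esub> cut_shift =
            \<zero>\<^bsub>R\<^esub> \<oplus>\<^bsub>R\<^esub> row_matrix (binomial_row 0)"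
          using bin by simp
      qed
      \<comment> \<open>\<open>k choose nat m\<close> is 0 for \<open>0 \<le> k < m\<close>, so only
        zero rows of \<open>d\<close> contribute.\<close>
      show "row_matrix (binomial_row (nat m)) \<otimes>\<^bsub>R\<^esub> d = \<zero>\<^bsub>R\<^esub>"
        unfolding R_def
        by (rule row_matrix_mult_eq_0[of m]) (auto simp: drow binomial_row_def binomial_eq_0)
    qed
    then show False by (auto simp: R_def row_matrix_eq_0_iff binomial_row_def dest: spec[of _ 0])
  qed
qed

theorem theorem2p4:
  shows "\<not> strongly_clean (laurent_matrix_ring :: (int \<Rightarrow> int \<Rightarrow> 'a::field) ring)"
  using cut_shift_not_strongly_clean laurent_matrix_cut_shift
  by (auto simp: strongly_clean_def laurent_matrix_ring_def)

end
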